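(* For every $m\in\mathbb{N}_0$ and $k\in\mathbb{N}$, $$\sum_{n=1}^\infty\frac{1}{4^n}\binom{2n}{n}\frac{t_n(1_k)}{n^{m+1}}=\frac{1}{2^k}R(k+1,1_m)\in\mathbb{Q}[\log2,\zeta(2),\zeta(3),\zeta(4),\dots].$$
   Context: $t_n(1_k)=\sum_{n\ge n_1>\cdots>n_k>0}\prod_{j=1}^k(2n_j-1)^{-1}$, and $1_m$ is the string of $m$ ones. For positive integers $k_1\ge2,k_2,\dots,k_r$, the multiple $R$-value is $R(k_1,\dots,k_r)=2^{k_1+\cdots+k_r}\sum_{n_1>\cdots>n_r>0}\frac{1}{(2n_1-1)^{k_1}(2n_2)^{k_2}\cdots(2n_r)^{k_r}}$. $\zeta$ is the Riemann zeta function. *)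

theory Defs
  imports "HOL-Analysis.Analysis"
begin

text \<open>
  The index tuples \<open>n\<^sub>1 > \<dots> > n\<^sub>r > 0\<close> are represented as lists, so \<open>n\<^sub>j\<close> is \<open>ns ! (j - 1)\<close>.
\<close>

definition decreasing_tuples :: "nat \<Rightarrow> nat list set" where
  "decreasing_tuples r = {ns. length ns = r \<and> sorted_wrt (>) ns \<and> (\<forall>n\<in>set ns. n > 0)}"

definition bounded_decreasing_tuples :: "nat \<Rightarrow> nat \<Rightarrow> nat list set" where
  "bounded_decreasing_tuples n r = {ns \<in> decreasing_tuples r. \<forall>i\<in>set ns. i \<le> n}"

lemma finite_bounded_decreasing_tuples: "finite (bounded_decreasing_tuples n r)"
  by (rule finite_subset[OF _ finite_lists_length_eq[of "{..n}" r]])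
     (auto simp: bounded_decreasing_tuples_def decreasing_tuples_def)

definition multiple_t_harmonic :: "nat \<Rightarrow> nat list \<Rightarrow> real" where
  "multiple_t_harmonic n ks =
     (\<Sum>ns\<in>bounded_decreasing_tuples n (length ks).
        \<Prod>j<length ks. 1 / (2 * real (ns ! j) - 1) ^ (ks ! j))"

text \<open>
  The multiple \<open>R\<close>-value of a nonempty list of positive exponents with first entry at least 2.
  All terms of the series are positive, so its value does not depend on the order of summation.
\<close>

definition multiple_R_value :: "nat list \<Rightarrow> real" where
  "multiple_R_value ks =
     2 ^ sum_list ks *
     (\<Sum>\<^sub>\<infinity>ns\<in>decreasing_tuples (length ks).
        1 / ((2 * real (ns ! 0) - 1) ^ (ks ! 0) *
             (\<Prod>j=1..<length ks. (2 * real (ns ! j)) ^ (ks ! j))))"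

text \<open>The Riemann zeta function at integer arguments \<open>s \<ge> 2\<close>.\<close>

definition zeta_value :: "nat \<Rightarrow> real" where
  "zeta_value s = (\<Sum>n. 1 / real (Suc n) ^ s)"

text \<open>
  \<open>rational_adjoin S\<close> is \<open>\<rat>[S]\<close>, the smallest subring of the reals containing the rational
  numbers and \<open>S\<close>; closure under negation follows because \<open>-1\<close> is rational.
\<close>

inductive_set rational_adjoin :: "real set \<Rightarrow> real set" for S :: "real set" where
  rational: "q \<in> \<rat> \<Longrightarrow> q \<in> rational_adjoin S"
| generator: "x \<in> S \<Longrightarrow> x \<in> rational_adjoin S"
| add: "x \<in> rational_adjoin S \<Longrightarrow> y \<in> rational_adjoin S \<Longrightarrow> x + y \<in> rational_adjoin S"
| mult: "x \<in> rational_adjoin S \<Longrightarrow> y \<in> rational_adjoin S \<Longrightarrow> x * y \<in> rational_adjoin S"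

end

(*
  Summing over n_1 = l first, 2^-k R(k+1, 1_m) = V := sum_l 2 e_m(1, ..., 1/(l-1)) / (2l-1)^(k+1), where
  e_m is the elementary symmetric polynomial. With the connector C(n,l) = n! l! / (n+l)!, telescoping gives
    1/n^(m+1) = sum_l e_m(1, ..., 1/(l-1)) C(n,l) / l,
    sum_n 4^-n binom(2n,n) t_n(1_k) C(n,l) = 2l / (2l-1)^(k+1),
  so the series equals V by interchanging two nonnegative sums.

  For the second claim put u_n = 1/(n - 1/2 - y/2), a power series in y, and
  W_N = prod_{n<=N} (1 - u_n x) / (1 - x/n), whose limit is a quotient of Gamma functions. Newton's
  identities express the coefficients of W_N through those of the power sums of 1/n and u_n, which
  converge to rational combinations of log 2 and zeta values. On the other hand, the partial
  fraction expansion of W_N in y exhibits the coefficient of x^(m+1) y^k as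
  -sum_{n<=N} 2/(2n-1)^(k+1) times a quantity tending to e_m(1, ..., 1/(n-1)), and Tannery's
  theorem identifies its limit as -V.
*)
theory Submission
  imports Defs "HOL-Real_Asymp.Real_Asymp"
begin

subsection \<open>Sums over decreasing tuples\<close>

lemma prod_nth_eq_prod_list: "(\<Prod>j<length xs. f (xs ! j)) = prod_list (map f xs)"
  for f :: "'a \<Rightarrow> 'b::comm_monoid_mult"
  by (simp add: prod.list_conv_set_nth atLeast0LessThan)

text \<open>The variables are \<open>f 1\<close>, ..., \<open>f n\<close>; the recursion splits by
  whether the last one is used.\<close>

fun elem_sym :: "(nat \<Rightarrow> real) \<Rightarrow> nat \<Rightarrow> nat \<Rightarrow> real" where
  "elem_sym f n 0 = 1"
| "elem_sym f 0 (Suc m) = 0"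
| "elem_sym f (Suc n) (Suc m) = elem_sym f n (Suc m) + f (Suc n) * elem_sym f n m"

lemma bounded_decreasing_tuples_0: "bounded_decreasing_tuples n 0 = {[]}"
  by (auto simp: bounded_decreasing_tuples_def decreasing_tuples_def)

lemma bounded_decreasing_tuples_0_Suc: "bounded_decreasing_tuples 0 (Suc m) = {}"
  by (auto simp: bounded_decreasing_tuples_def decreasing_tuples_def length_Suc_conv)

text \<open>Either the largest entry is at most n or it is n + 1, which matches the recursion of
  \<open>elem_sym\<close>.\<close>

lemma bounded_decreasing_tuples_Suc_Suc:
  "bounded_decreasing_tuples (Suc n) (Suc m) =
     bounded_decreasing_tuples n (Suc m) \<union> (#) (Suc n) ` bounded_decreasing_tuples n m"
proof (intro equalityI subsetI)
  fix ns
  assume "ns \<in> bounded_decreasing_tuples (Suc n) (Suc m)"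
  then obtain a xs where ns: "ns = a # xs" "length xs = m" "sorted_wrt (>) xs" "\<forall>x\<in>set xs. x < a"
    "a > 0" "\<forall>x\<in>set xs. x > 0" "a \<le> Suc n"
    by (auto simp: bounded_decreasing_tuples_def decreasing_tuples_def length_Suc_conv)
  show "ns \<in> bounded_decreasing_tuples n (Suc m) \<union> (#) (Suc n) ` bounded_decreasing_tuples n m"
  proof (cases "a = Suc n")
    case True
    then show ?thesis
      using ns by (auto simp: bounded_decreasing_tuples_def decreasing_tuples_def less_Suc_eq_le le_SucI)
  next
    case False
    then have "a \<le> n"
      using ns by simp
    then show ?thesis
      using ns by (auto simp: bounded_decreasing_tuples_def decreasing_tuples_def dest: less_imp_le_nat)
  qed
qed (auto simp: bounded_decreasing_tuples_def decreasing_tuples_def less_Suc_eq_le le_SucI)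

lemma sum_bounded_decreasing_tuples:
  "(\<Sum>ns\<in>bounded_decreasing_tuples n m. prod_list (map f ns)) = elem_sym f n m"
proof (induction f n m rule: elem_sym.induct)
  case (3 f n m)
  have "bounded_decreasing_tuples n (Suc m) \<inter> (#) (Suc n) ` bounded_decreasing_tuples n m = {}"
    by (auto simp: bounded_decreasing_tuples_def)
  then show ?case
    using 3 by (simp add: bounded_decreasing_tuples_Suc_Suc sum.union_disjoint
        finite_bounded_decreasing_tuples sum.reindex sum_distrib_left[symmetric])
qed (simp_all add: bounded_decreasing_tuples_0 bounded_decreasing_tuples_0_Suc)

lemma elem_sym_nonneg:
  assumes "\<And>j. f (Suc j) \<ge> 0"
  shows "elem_sym f n m \<ge> 0"
  using assms by (induction f n m rule: elem_sym.induct) auto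

text \<open>With h = \<open>harm n\<close> and t = 1/(n+1), the induction step is h^(m+1) + t h^m =
  h^m (h + t) \<le> (h + t)^(m+1). So these sums grow at most like powers of log n.\<close>

lemma elem_sym_le_power:
  assumes "\<And>j. f (Suc j) \<ge> 0" "\<And>j. f (Suc j) \<le> 1 / real (Suc j)"
  shows "elem_sym f n m \<le> harm n ^ m"
  using assms
proof (induction f n m rule: elem_sym.induct)
  case (3 f n m)
  let ?h = "harm n :: real" and ?t = "1 / real (Suc n)"
  have "elem_sym f (Suc n) (Suc m) \<le> ?h ^ Suc m + ?t * ?h ^ m"
    unfolding elem_sym.simps using 3 by (intro add_mono mult_mono elem_sym_nonneg) auto
  also have "\<dots> = ?h ^ m * (?h + ?t)"
    by (simp add: algebra_simps)
  also have "\<dots> \<le> (?h + ?t) ^ m * (?h + ?t)"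
    by (intro mult_right_mono power_mono add_nonneg_nonneg) (auto simp: harm_nonneg)
  also have "\<dots> = harm (Suc n) ^ Suc m"
    by (simp add: harm_Suc divide_inverse)
  finally show ?case .
qed (auto simp: harm_nonneg)

lemma harm_le_1_plus_ln: "n > 0 \<Longrightarrow> harm n \<le> 1 + ln (real n)"
  using euler_mascheroni_sequence_decreasing[of 1 n] by (simp add: harm_expand)

section \<open>Central binomial weights\<close>

definition central_weight :: "nat \<Rightarrow> real" where
  "central_weight n = real ((2 * n) choose n) / 4 ^ n"

lemma central_weight_Suc:
  "central_weight (Suc n) * (2 * real n + 2) = central_weight n * (2 * real n + 1)"
proof -
  have fact: "real ((2 * n) choose n) = fact (2 * n) / (fact n * fact n)" for n
    by (simp add: binomial_fact)
  have binomial: "real ((2 * Suc n) choose Suc n) * (real n + 1)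
      = 2 * (2 * real n + 1) * real ((2 * n) choose n)"
    unfolding fact by (simp add: divide_simps) (simp add: algebra_simps)
  have "central_weight (Suc n) * (2 * real n + 2)
      = (real ((2 * Suc n) choose Suc n) * (real n + 1)) * 2 / (4 * 4 ^ n)"
    by (simp add: central_weight_def algebra_simps del: binomial_Suc_Suc)
  also have "\<dots> = central_weight n * (2 * real n + 1)"
    unfolding binomial by (simp add: central_weight_def field_simps)
  finally show ?thesis .
qed

lemma central_weight_pos: "central_weight n > 0"
  by (simp add: central_weight_def)

text \<open>The squared weight times 2n + 1 does not increase with n, because (2n+1)(2n+3) \<le>
  (2n+2)^2.\<close>

lemma central_weight_bound: "central_weight n \<le> 1 / sqrt (2 * real n + 1)"
proof -
  have "(central_weight n)\<^sup>2 * (2 * real n + 1) \<le> 1"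
  proof (induction n)
    case (Suc n)
    have "(central_weight (Suc n) * (2 * real n + 2))\<^sup>2 * (2 * real n + 3)
        = ((central_weight n)\<^sup>2 * (2 * real n + 1)) * ((2 * real n + 1) * (2 * real n + 3))"
      unfolding central_weight_Suc by (simp add: power2_eq_square algebra_simps)
    also have "\<dots> \<le> 1 * ((2 * real n + 2) ^ 2)"
      by (intro mult_mono Suc.IH) (auto simp: power2_eq_square algebra_simps)
    finally have "((central_weight (Suc n))\<^sup>2 * (2 * real n + 3)) * (2 * real n + 2)\<^sup>2
        \<le> 1 * (2 * real n + 2)\<^sup>2"
      by (simp add: power_mult_distrib mult_ac)
    then have "(central_weight (Suc n))\<^sup>2 * (2 * real n + 3) \<le> 1"
      by (rule mult_right_le_imp_le) (auto simp: add_pos_nonneg)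
    then show ?case
      by (simp add: algebra_simps)
  qed (simp add: central_weight_def)
  then have "sqrt ((central_weight n)\<^sup>2 * (2 * real n + 1)) \<le> 1"
    by simp
  then have "central_weight n * sqrt (2 * real n + 1) \<le> 1"
    using central_weight_pos[of n] by (simp add: real_sqrt_mult)
  then show ?thesis
    by (simp add: pos_le_divide_eq)
qed

definition t_weight :: "nat \<Rightarrow> nat \<Rightarrow> real" where
  "t_weight n k = central_weight n * elem_sym (\<lambda>j. 1 / (2 * real j - 1)) n k"

lemma t_weight_nonneg: "t_weight n k \<ge> 0"
  unfolding t_weight_def using central_weight_pos[of n]
  by (intro mult_nonneg_nonneg elem_sym_nonneg) auto

lemma t_weight_0: "t_weight 0 k = (if k = 0 then 1 else 0)"
  by (cases k) (auto simp: t_weight_def central_weight_def)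

lemma t_weight_Suc_0: "t_weight (Suc n) 0 * (2 * real n + 2) = t_weight n 0 * (2 * real n + 1)"
  using central_weight_Suc[of n] by (simp add: t_weight_def)

text \<open>The factor 2n + 1 from the weight cancels the denominator of the new variable 1/(2n+1),
  so the recursion is free of division.\<close>

lemma t_weight_Suc_Suc:
  "t_weight (Suc n) (Suc k) * (2 * real n + 2)
    = t_weight n (Suc k) * (2 * real n + 1) + t_weight n k"
proof -
  have "t_weight (Suc n) (Suc k) * (2 * real n + 2)
     = (central_weight (Suc n) * (2 * real n + 2)) *
       (elem_sym (\<lambda>j. 1 / (2 * real j - 1)) n (Suc k)
         + elem_sym (\<lambda>j. 1 / (2 * real j - 1)) n k / (2 * real n + 1))"
    by (simp add: t_weight_def algebra_simps)
  also have "\<dots> = t_weight n (Suc k) * (2 * real n + 1) + t_weight n k"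
    unfolding central_weight_Suc by (simp add: t_weight_def field_simps)
  finally show ?thesis .
qed

text \<open>Powers of log n lose against the decay n^(-1/2) of the weight. This removes the boundary
  terms at infinity when telescoping in n.\<close>

lemma tendsto_t_weight: "(\<lambda>n. t_weight n k) \<longlonglongrightarrow> 0"
proof (rule tendsto_sandwich)
  show "\<forall>\<^sub>F n in sequentially. 0 \<le> t_weight n k"
    by (simp add: t_weight_nonneg)
  show "\<forall>\<^sub>F n in sequentially. t_weight n k \<le> 1 / sqrt (2 * real n + 1) * (1 + ln (real n)) ^ k"
  proof (intro eventually_mono[OF eventually_gt_at_top[of 0]])
    fix n :: nat
    assume n: "n > 0"
    have "elem_sym (\<lambda>j. 1 / (2 * real j - 1)) n k \<le> harm n ^ k"
      by (rule elem_sym_le_power) (auto simp: field_simps)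
    also have "\<dots> \<le> (1 + ln (real n)) ^ k"
      by (intro power_mono harm_le_1_plus_ln n harm_nonneg)
    finally show "t_weight n k \<le> 1 / sqrt (2 * real n + 1) * (1 + ln (real n)) ^ k"
      unfolding t_weight_def using central_weight_bound[of n]
      by (intro mult_mono elem_sym_nonneg) auto
  qed
  show "(\<lambda>n. 1 / sqrt (2 * real n + 1) * (1 + ln (real n)) ^ k) \<longlonglongrightarrow> 0"
    by real_asymp
qed simp

subsection \<open>The connected sums\<close>

text \<open>The reciprocal of the binomial coefficient of n + l over n.\<close>

definition connector :: "nat \<Rightarrow> nat \<Rightarrow> real" where
  "connector n l = fact n * fact l / fact (n + l)"

lemma connector_nonneg: "connector n l \<ge> 0"
  by (simp add: connector_def)

lemma connector_commute: "connector n l = connector l n"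
  by (simp add: connector_def add.commute mult.commute)

lemma connector_Suc_left: "connector (Suc n) l * (real n + real l + 1) = connector n l * (real n + 1)"
proof -
  define d where "d = real n + real l + 1"
  have "d \<noteq> 0" "fact (Suc n + l) = d * fact (n + l)"
    by (auto simp: d_def algebra_simps)
  then show ?thesis
    unfolding connector_def d_def[symmetric] by simp
qed

lemma connector_Suc_right: "connector n (Suc l) * (real n + real l + 1) = connector n l * (real l + 1)"
  using connector_Suc_left[of l n] by (simp add: connector_commute add_ac)

lemma connector_le_1: "connector n l \<le> 1"
proof (induction n)
  case (Suc n)
  have "connector (Suc n) l * (real n + real l + 1) \<le> 1 * (real n + real l + 1)"
    unfolding connector_Suc_left using Suc connector_nonneg by (intro mult_mono) auto
  then show ?case
    by (rule mult_right_le_imp_le) simp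
qed (simp add: connector_def)

text \<open>Equality holds at n = 1, and the connector decreases in n. The decay in l beats powers
  of log l, which removes the boundary terms when telescoping in l.\<close>

lemma connector_le_inverse:
  assumes "n > 0"
  shows "connector n l \<le> 1 / (real l + 1)"
proof -
  obtain n' where n: "n = Suc n'"
    using assms gr0_conv_Suc by auto
  have "connector (Suc n') l * (real l + 1) \<le> 1"
  proof (induction n')
    case (Suc n')
    have "connector (Suc (Suc n')) l * (real (Suc n') + real l + 1) * (real l + 1)
       = connector (Suc n') l * (real l + 1) * (real (Suc n') + 1)"
      unfolding connector_Suc_left by simp
    also have "\<dots> \<le> 1 * (real (Suc n') + real l + 1)"
      using Suc connector_nonneg by (intro mult_mono) auto
    finally have "(connector (Suc (Suc n')) l * (real l + 1)) * (real (Suc n') + real l + 1)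
       \<le> 1 * (real (Suc n') + real l + 1)"
      by (simp add: mult_ac)
    then show ?case
      by (rule mult_right_le_imp_le) simp
  qed (simp add: connector_def)
  then show ?thesis
    by (simp add: n field_simps)
qed

lemma tendsto_harmonic_elem_sym_connector:
  assumes "n > 0"
  shows "(\<lambda>L. elem_sym (\<lambda>j. 1 / real j) L m * connector n L) \<longlonglongrightarrow> 0"
proof (rule tendsto_sandwich)
  show "\<forall>\<^sub>F L in sequentially. 0 \<le> elem_sym (\<lambda>j. 1 / real j) L m * connector n L"
    by (intro always_eventually allI mult_nonneg_nonneg elem_sym_nonneg connector_nonneg) simp
  show "\<forall>\<^sub>F L in sequentially. elem_sym (\<lambda>j. 1 / real j) L m * connector n L
      \<le> (1 + ln (real L)) ^ m * (1 / (real L + 1))"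
  proof (intro eventually_mono[OF eventually_gt_at_top[of 0]])
    fix L :: nat
    assume L: "L > 0"
    have "elem_sym (\<lambda>j. 1 / real j) L m \<le> harm L ^ m"
      by (rule elem_sym_le_power) auto
    also have "\<dots> \<le> (1 + ln (real L)) ^ m"
      by (intro power_mono harm_le_1_plus_ln L harm_nonneg)
    finally show "elem_sym (\<lambda>j. 1 / real j) L m * connector n L
        \<le> (1 + ln (real L)) ^ m * (1 / (real L + 1))"
      using connector_le_inverse[OF assms, of L] L
      by (intro mult_mono connector_nonneg) auto
  qed
  show "(\<lambda>L. (1 + ln (real L)) ^ m * (1 / (real L + 1))) \<longlonglongrightarrow> 0"
    by real_asymp
qed simp

text \<open>
  Summation by parts: the difference of \<open>connector n\<close> at \<open>i\<close> and \<open>i + 1\<close> is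
  \<open>n * connector n (i + 1) / (i + 1)\<close>.
\<close>

lemma harmonic_elem_sym_connector_sums:
  assumes "n > 0"
  shows "(\<lambda>i. elem_sym (\<lambda>j. 1 / real j) i m * connector n (Suc i) / real (Suc i))
           sums (1 / real n ^ Suc m)"
proof (induction m)
  case 0
  have "connector n (Suc i) / real (Suc i) = (connector n i - connector n (Suc i)) / real n" for i
    using assms connector_Suc_right[of n i] by (simp add: field_simps)
  moreover have "(\<lambda>i. (connector n i - connector n (Suc i)) / real n) sums ((connector n 0 - 0) / real n)"
    using tendsto_harmonic_elem_sym_connector[OF assms, of 0]
    by (intro sums_divide telescope_sums') simp
  ultimately show ?case
    by (simp add: connector_def)
next
  case (Suc m)
  define e where "e = elem_sym (\<lambda>j. 1 / real j)"
  have eSuc: "e (Suc i) (Suc m) = e i (Suc m) + e i m / real (Suc i)" for i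
    by (simp add: e_def)
  \<comment> \<open>The variable 1/(i+1) that is new in \<open>e (Suc i) (Suc m)\<close> leaves as a
    correction the summand for \<open>m\<close>, whose sum is the induction hypothesis.\<close>
  have "e i (Suc m) * connector n (Suc i) / real (Suc i)
     = ((e i (Suc m) * connector n i - e (Suc i) (Suc m) * connector n (Suc i))
        + e i m * connector n (Suc i) / real (Suc i)) / real n" for i
  proof -
    have "connector n i = connector n (Suc i) * (real n + real (Suc i)) / real (Suc i)"
      using connector_Suc_right[of n i] by (simp add: field_simps)
    moreover have "E * c / I = ((E * (c * (N + I) / I) - (E + F / I) * c) + F * c / I) / N"
      if "I > 0" "N > 0" for E F c N I :: real
      using that by (simp add: field_simps)
    ultimately show ?thesis
      unfolding eSuc using assms by simp
  qed
  moreover have "(\<lambda>i. ((e i (Suc m) * connector n i - e (Suc i) (Suc m) * connector n (Suc i))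
        + e i m * connector n (Suc i) / real (Suc i)) / real n)
      sums (((e 0 (Suc m) * connector n 0 - 0) + 1 / real n ^ Suc m) / real n)"
    using tendsto_harmonic_elem_sym_connector[OF assms, of "Suc m"] Suc
    unfolding e_def by (intro sums_divide sums_add telescope_sums') auto
  ultimately have "(\<lambda>i. e i (Suc m) * connector n (Suc i) / real (Suc i))
      sums (((e 0 (Suc m) * connector n 0 - 0) + 1 / real n ^ Suc m) / real n)"
    by (simp only:)
  then show ?case
    by (simp add: e_def mult_ac)
qed

text \<open>Telescoping in n: twice the difference of \<open>V (Suc k)\<close> is 2l + 1 times the
  summand for \<open>Suc k\<close> minus the summand for \<open>k\<close>. Each step in k thus
  divides the sum by 2l + 1; the boundary term at n = 0 is nonzero only for k = 0.\<close>

lemma t_weight_connector_sums: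
  "(\<lambda>n. t_weight n k * connector n (Suc l)) sums (2 * real (Suc l) / (2 * real l + 1) ^ Suc k)"
proof -
  define V where "V k n = t_weight n k * connector n l * real (Suc l)" for k n
  have lim: "V k \<longlonglongrightarrow> 0" for k
  proof (rule tendsto_sandwich)
    show "\<forall>\<^sub>F n in sequentially. 0 \<le> V k n"
      by (simp add: V_def t_weight_nonneg connector_nonneg)
    have "V k n \<le> t_weight n k * 1 * real (Suc l)" for n
      unfolding V_def by (intro mult_mono connector_le_1) (auto simp: t_weight_nonneg connector_nonneg)
    then show "\<forall>\<^sub>F n in sequentially. V k n \<le> t_weight n k * real (Suc l)"
      by simp
    show "(\<lambda>n. t_weight n k * real (Suc l)) \<longlonglongrightarrow> 0"
      using tendsto_mult_left_zero[OF tendsto_t_weight] by blast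
  qed simp
  \<comment> \<open>The factor l + 1 in \<open>V\<close> lets both neighbouring terms be written as
    multiples of the same \<open>connector n (Suc l)\<close>.\<close>
  have C: "connector n l * real (Suc l) = connector n (Suc l) * (real n + real l + 1)"
    "connector (Suc n) l * real (Suc l) = connector n (Suc l) * real (Suc n)" for n
  proof -
    show right: "connector n l * real (Suc l) = connector n (Suc l) * (real n + real l + 1)" for n
      using connector_Suc_right[of n l] by (simp add: add.commute)
    have "connector (Suc n) l * real (Suc l) * (real n + real l + 1)
        = connector n l * real (Suc l) * (real n + 1)"
      using connector_Suc_left[of n l] by simp
    also have "\<dots> = connector n (Suc l) * real (Suc n) * (real n + real l + 1)"
      unfolding right by (simp add: add.commute)
    finally show "connector (Suc n) l * real (Suc l) = connector n (Suc l) * real (Suc n)"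
      by simp
  qed
  show ?thesis
  proof (induction k)
    case 0
    have "2 * (V 0 n - V 0 (Suc n)) = t_weight n 0 * connector n (Suc l) * (2 * real l + 1)" for n
    proof -
      have "2 * V 0 (Suc n) = t_weight (Suc n) 0 * (2 * real n + 2) * connector n (Suc l)"
        unfolding V_def mult.assoc C(2) by (simp add: algebra_simps)
      then show ?thesis
        unfolding t_weight_Suc_0 V_def right_diff_distrib mult.assoc C(1) by (simp add: algebra_simps)
    qed
    moreover have "(\<lambda>n. 2 * (V 0 n - V 0 (Suc n)) / (2 * real l + 1)) sums (2 * (V 0 0 - 0) / (2 * real l + 1))"
      by (intro sums_divide sums_mult telescope_sums' lim)
    ultimately show ?case
      by (simp add: V_def t_weight_0 connector_def)
  next
    case (Suc k)
    have "2 * (V (Suc k) n - V (Suc k) (Suc n)) + t_weight n k * connector n (Suc l)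
       = t_weight n (Suc k) * connector n (Suc l) * (2 * real l + 1)" for n
    proof -
      have "2 * V (Suc k) (Suc n) = t_weight (Suc n) (Suc k) * (2 * real n + 2) * connector n (Suc l)"
        unfolding V_def mult.assoc C(2) by (simp add: algebra_simps)
      then show ?thesis
        unfolding t_weight_Suc_Suc V_def right_diff_distrib mult.assoc C(1) by (simp add: algebra_simps)
    qed
    moreover have "(\<lambda>n. (2 * (V (Suc k) n - V (Suc k) (Suc n)) + t_weight n k * connector n (Suc l)) / (2 * real l + 1))
        sums ((2 * (V (Suc k) 0 - 0) + 2 * real (Suc l) / (2 * real l + 1) ^ Suc k) / (2 * real l + 1))"
      by (intro sums_divide sums_add sums_mult telescope_sums' lim Suc)
    ultimately show ?case
      by (simp add: V_def t_weight_0 mult_ac)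
  qed
qed

subsection \<open>Partial fractions and logarithmic derivatives\<close>

text \<open>
  The family \<open>v n = 1 / (n - a)\<close> is characterised by the resolvent identity, which makes sense in a ring
  without division; \<open>r j\<close> stands for \<open>1 / j\<close>. The value at \<open>a = N + 1\<close> of the induction hypothesis is
  the coefficient of the new pole.
\<close>

lemma prod_one_minus_partial_fractions:
  fixes v r :: "nat \<Rightarrow> 'a::comm_ring_1" and x :: 'a
  assumes r: "\<And>j. j > 0 \<Longrightarrow> r j * of_nat j = 1"
    and v: "\<And>n j. 0 < n \<Longrightarrow> n < j \<Longrightarrow> j \<le> N \<Longrightarrow> v n * v j * of_nat (j - n) = v n - v j"
  shows "(\<Prod>n=1..N. 1 - x * v n) =
    1 - x * (\<Sum>n=1..N. v n * (\<Prod>j=1..<n. 1 + x * r j) * (\<Prod>j=1..N-n. 1 - x * r j))"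
  using v
proof (induction N arbitrary: v)
  case (Suc N)
  define E where "E n = (\<Prod>j=1..<n. 1 + x * r j)" for n
  define G where "G n = (\<Prod>j=1..n. 1 - x * r j)" for n
  \<comment> \<open>The induction hypothesis covers every resolvent family, in particular 1/(n - a)
    at a = N + 1, which is \<open>- r (Suc N - n)\<close>. Reversing the index turns its product
    into \<open>E (Suc N)\<close>.\<close>
  have "(\<Prod>n=1..N. 1 - x * (- r (Suc N - n))) = 1 - x * (\<Sum>n=1..N. - r (Suc N - n) * E n * G (N - n))"
    unfolding E_def G_def
  proof (rule Suc.IH)
    fix n j
    assume nj: "0 < n" "n < j" "j \<le> N"
    define a b where "a = Suc N - n" and "b = Suc N - j"
    have ab: "a > 0" "b > 0" "j - n = a - b" "b \<le> a"
      using nj by (auto simp: a_def b_def)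
    have "r a * r b * of_nat (a - b) = (r a * of_nat a) * r b - r a * (r b * of_nat b)"
      using ab by (simp add: of_nat_diff algebra_simps)
    then have "r a * r b * of_nat (a - b) = r b - r a"
      using r[of a] r[of b] ab by (simp only: mult_1_left mult_1_right)
    then show "- r (Suc N - n) * - r (Suc N - j) * of_nat (j - n) = - r (Suc N - n) - - r (Suc N - j)"
      unfolding ab(3) a_def[symmetric] b_def[symmetric] by simp
  qed
  moreover have "(\<Prod>n=1..N. 1 - x * (- r (Suc N - n))) = E (Suc N)"
    unfolding E_def atLeastLessThanSuc_atLeastAtMost
    by (rule prod.reindex_bij_witness[of _ "\<lambda>n. Suc N - n" "\<lambda>n. Suc N - n"]) auto
  ultimately have E_Suc: "E (Suc N) = 1 + x * (\<Sum>n=1..N. r (Suc N - n) * E n * G (N - n))"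
    by (simp add: sum_negf)
  have resolvent: "v n * v (Suc N) = r (Suc N - n) * (v n - v (Suc N))" if "n \<in> {1..N}" for n
  proof -
    have "v n * v (Suc N) = (v n * v (Suc N) * of_nat (Suc N - n)) * r (Suc N - n)"
      using r[of "Suc N - n"] that by (simp add: mult_ac)
    also have "v n * v (Suc N) * of_nat (Suc N - n) = v n - v (Suc N)"
      using that by (intro Suc.prems) auto
    finally show ?thesis
      by (simp add: mult.commute)
  qed
  have G_Suc: "G (Suc N - n) = G (N - n) * (1 - x * r (Suc N - n))" if "n \<in> {1..N}" for n
    using that by (simp add: G_def Suc_diff_le)
  have "(\<Prod>n=1..Suc N. 1 - x * v n) = (1 - x * (\<Sum>n=1..N. v n * E n * G (N - n))) * (1 - x * v (Suc N))"
    using Suc by (simp add: E_def G_def)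
  also have "\<dots> = 1 - x * ((\<Sum>n=1..N. v n * E n * G (N - n)) + v (Suc N)
      - x * (\<Sum>n=1..N. v n * v (Suc N) * E n * G (N - n)))"
    by (simp add: algebra_simps sum_distrib_left sum_distrib_right sum_subtractf)
  also have "(\<Sum>n=1..N. v n * v (Suc N) * E n * G (N - n))
      = (\<Sum>n=1..N. r (Suc N - n) * (v n - v (Suc N)) * E n * G (N - n))"
    by (intro sum.cong refl) (simp only: resolvent)
  \<comment> \<open>The terms with \<open>v n\<close> extend \<open>G (N - n)\<close> to
    \<open>G (Suc N - n)\<close>; those with \<open>v (Suc N)\<close> add up to
    \<open>E (Suc N)\<close> by \<open>E_Suc\<close>.\<close>
  also have "(\<Sum>n=1..N. v n * E n * G (N - n)) + v (Suc N) - x * \<dots>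
     = (\<Sum>n=1..N. v n * E n * (G (N - n) * (1 - x * r (Suc N - n))))
       + v (Suc N) * (1 + x * (\<Sum>n=1..N. r (Suc N - n) * E n * G (N - n)))"
    by (simp add: algebra_simps sum_distrib_left sum.distrib sum_subtractf)
  also have "\<dots> = (\<Sum>n=1..N. v n * E n * G (Suc N - n)) + v (Suc N) * E (Suc N)"
    unfolding E_Suc[symmetric] by (simp add: G_Suc)
  also have "\<dots> = (\<Sum>n=1..Suc N. v n * E n * G (Suc N - n))"
    by (simp add: G_def)
  finally show ?case
    by (simp add: E_def G_def)
qed simp

text \<open>The expansion of 1/(1 - c X), given by coefficients so that \<open>c\<close> may itself
  be a power series.\<close>

definition geometric_fps :: "'a::comm_semiring_1 \<Rightarrow> 'a fps" where
  "geometric_fps c = Abs_fps (\<lambda>i. c ^ i)"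

lemma geometric_fps_nth [simp]: "fps_nth (geometric_fps c) i = c ^ i"
  by (simp add: geometric_fps_def)

lemma one_minus_times_geometric_fps:
  "(1 - fps_const c * fps_X) * geometric_fps c = 1" for c :: "'a::comm_ring_1"
proof (rule fps_ext)
  fix i
  show "fps_nth ((1 - fps_const c * fps_X) * geometric_fps c) i = fps_nth 1 i"
    by (cases i) (simp_all add: ring_distribs mult.assoc)
qed

text \<open>Differentiate (1 - c X) g = 1 and multiply by g.\<close>

lemma fps_deriv_geometric_fps:
  "fps_deriv (geometric_fps c) = fps_const c * geometric_fps c * geometric_fps c" for c :: "'a::comm_ring_1"
proof -
  let ?d = "1 - fps_const c * fps_X" and ?g = "geometric_fps c"
  have "fps_deriv (?d * ?g) = 0"
    by (simp only: one_minus_times_geometric_fps) simp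
  then have "?d * fps_deriv ?g = fps_const c * ?g"
    by (simp add: algebra_simps)
  then have "(?d * ?g) * fps_deriv ?g = fps_const c * ?g * ?g"
    by (simp only: mult_ac) 
  then show ?thesis
    by (simp only: one_minus_times_geometric_fps) simp
qed

lemma fps_deriv_ratio:
  fixes a b :: "'a::comm_ring_1"
  defines "f \<equiv> (1 - fps_const a * fps_X) * geometric_fps b"
  shows "fps_deriv f = f * (fps_const b * geometric_fps b - fps_const a * geometric_fps a)"
proof -
  define A B d g where "A = fps_const a" and "B = fps_const b"
    and "d = 1 - fps_const a * fps_X" and "g = geometric_fps b"
  have "fps_deriv f = - A * g + d * (B * g * g)"
    by (simp add: f_def fps_deriv_geometric_fps A_def B_def d_def g_def)
  also have "\<dots> = - A * (d * geometric_fps a) * g + d * (B * g * g)"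
    by (simp add: d_def one_minus_times_geometric_fps)
  also have "\<dots> = d * g * (B * g - A * geometric_fps a)"
    by (simp add: algebra_simps)
  finally show ?thesis
    by (simp only: f_def A_def B_def d_def g_def)
qed

text \<open>Logarithmic derivatives add under products. The last factor generates the differences of
  the power sums of \<open>b\<close> and \<open>a\<close>, which is the source of Newton's
  identities.\<close>

lemma fps_deriv_prod_ratio:
  fixes a b :: "nat \<Rightarrow> 'a::comm_ring_1"
  shows "fps_deriv (\<Prod>n=1..N. (1 - fps_const (a n) * fps_X) * geometric_fps (b n))
    = (\<Prod>n=1..N. (1 - fps_const (a n) * fps_X) * geometric_fps (b n))
      * (\<Sum>n=1..N. fps_const (b n) * geometric_fps (b n) - fps_const (a n) * geometric_fps (a n))"
proof (induction N)
  case (Suc N)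
  have "fps_deriv (p * f) = (p * f) * (q + c)"
    if "fps_deriv p = p * q" "fps_deriv f = f * c" for p f q c :: "'a fps"
    using that by (simp add: algebra_simps)
  from this[OF Suc.IH fps_deriv_ratio] show ?case
    by simp
qed simp

subsection \<open>Limits of the coefficients\<close>

lemma rational_adjoin_minus: "x \<in> rational_adjoin S \<Longrightarrow> - x \<in> rational_adjoin S"
  using rational_adjoin.mult[OF rational_adjoin.rational[of "-1"]] by force

lemma rational_adjoin_sum:
  assumes "\<And>i. i \<in> I \<Longrightarrow> f i \<in> rational_adjoin S"
  shows "sum f I \<in> rational_adjoin S"
  using assms
  by (induction I rule: infinite_finite_induct) (auto intro: rational_adjoin.intros)

lemma zeta_value_sums:
  assumes "s \<ge> 2"
  shows "(\<lambda>n. 1 / real (Suc n) ^ s) sums zeta_value s"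
proof -
  have "summable (\<lambda>n. 1 / real (Suc n) ^ s)"
    using inverse_power_summable[OF assms, where ?'a = real, THEN summable_Suc_iff[THEN iffD2]]
    by (simp add: divide_inverse)
  then show ?thesis
    by (simp add: zeta_value_def summable_sums)
qed

text \<open>The first N odd terms are the first 2N terms of the zeta series without the even ones,
  and the even ones are 2^(-s) times its first N terms.\<close>

lemma odd_zeta_sums:
  assumes "s \<ge> 2"
  shows "(\<lambda>n. 1 / (2 * real (Suc n) - 1) ^ s) sums ((1 - 1 / 2 ^ s) * zeta_value s)"
proof -
  let ?z = "\<lambda>N. \<Sum>n<N. 1 / real (Suc n) ^ s"
  have "(\<Sum>n<N. 1 / (2 * real (Suc n) - 1) ^ s) = ?z (2 * N) - 1 / 2 ^ s * ?z N" for N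
  proof (induction N)
    case (Suc N)
    have "(2 + 2 * real N) ^ s = 2 ^ s * (1 + real N) ^ s"
      by (simp add: power_mult_distrib[symmetric] algebra_simps)
    then show ?case
      using Suc by (simp add: algebra_simps)
  qed simp
  moreover have z: "?z \<longlonglongrightarrow> zeta_value s"
    using zeta_value_sums[OF assms] by (simp add: sums_def)
  moreover have "(\<lambda>N. ?z (2 * N)) \<longlonglongrightarrow> zeta_value s"
    by (rule filterlim_compose[OF z]) (simp add: filterlim_subseq strict_mono_def)
  ultimately have "(\<lambda>N. \<Sum>n<N. 1 / (2 * real (Suc n) - 1) ^ s) \<longlonglongrightarrow> zeta_value s - 1 / 2 ^ s * zeta_value s"
    by (simp only:) (intro tendsto_intros)
  then show ?thesis
    by (simp add: sums_def algebra_simps)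
qed

abbreviation zeta_log_ring :: "real set" where
  "zeta_log_ring \<equiv> rational_adjoin ({ln 2} \<union> {zeta_value s |s. s \<ge> 2})"

lemma zeta_value_in_ring: "s \<ge> 2 \<Longrightarrow> zeta_value s \<in> zeta_log_ring"
  by (intro rational_adjoin.generator) auto

lemma odd_zeta_in_ring: "s \<ge> 2 \<Longrightarrow> (1 - 1 / 2 ^ s) * zeta_value s \<in> zeta_log_ring"
  by (intro rational_adjoin.mult rational_adjoin.rational zeta_value_in_ring) auto

text \<open>The expansion of \<open>1 / (n - 1/2 - y/2)\<close> in powers of \<open>y\<close>.\<close>

definition shifted_inverse :: "nat \<Rightarrow> real fps" where
  "shifted_inverse n = fps_const (2 / (2 * real n - 1)) * geometric_fps (1 / (2 * real n - 1))"

lemma shifted_inverse_nth: "fps_nth (shifted_inverse n) k = 2 / (2 * real n - 1) ^ Suc k"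
  by (simp add: shifted_inverse_def power_divide)

lemma shifted_inverse_mult:
  assumes "n > 0"
  shows "shifted_inverse n * (fps_const (real n) - fps_const (1/2) * (1 + fps_X)) = 1"
proof -
  \<comment> \<open>With this c, n - 1/2 - y/2 = (1 - c y)/(2c).\<close>
  define c where "c = 1 / (2 * real n - 1)"
  have "2 * real n - 1 > 0"
    using assms by simp
  then have n: "real n = 1 / (2 * c) + 1 / 2" "c \<noteq> 0"
    by (auto simp: c_def field_simps)
  have "fps_const (real n) - fps_const (1/2) * (1 + fps_X) = fps_const (1 / (2 * c)) * (1 - fps_const c * fps_X)"
    using n(2) unfolding n(1)
    by (intro fps_ext) (auto simp: field_simps fps_X_def fps_one_def)
  then have "shifted_inverse n * (fps_const (real n) - fps_const (1/2) * (1 + fps_X))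
    = (fps_const (2 * c) * fps_const (1 / (2 * c))) * ((1 - fps_const c * fps_X) * geometric_fps c)"
    by (simp add: shifted_inverse_def c_def mult_ac)
  also have "\<dots> = 1"
    using n(2) unfolding one_minus_times_geometric_fps by simp
  finally show ?thesis .
qed

text \<open>The series are inverse to n - 1/2 - y/2 and j - 1/2 - y/2, whose difference does not
  involve y. This is the hypothesis of the partial fraction expansion.\<close>

lemma shifted_inverse_resolvent:
  assumes "0 < n" "n < j"
  shows "shifted_inverse n * shifted_inverse j * of_nat (j - n) = shifted_inverse n - shifted_inverse j"
proof -
  define d where "d n = fps_const (real n) - fps_const (1/2) * (1 + fps_X)" for n
  have d: "of_nat (j - n) = d j - d n"
    using assms by (simp add: d_def fps_of_nat[symmetric] of_nat_diff)
  have "shifted_inverse n * d n = 1" "shifted_inverse j * d j = 1"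
    using assms by (auto simp: d_def intro!: shifted_inverse_mult)
  moreover have "shifted_inverse n * shifted_inverse j * of_nat (j - n)
     = shifted_inverse n * (shifted_inverse j * d j) - shifted_inverse j * (shifted_inverse n * d n)"
    unfolding d by (simp add: algebra_simps)
  ultimately show ?thesis
    by simp
qed

text \<open>Replacing y by c y multiplies the k-th coefficient by c^k.\<close>

lemma geometric_fps_power_nth:
  "fps_nth (geometric_fps c ^ s) k = c ^ k * fps_nth (geometric_fps 1 ^ s) k" for c :: "'a::comm_semiring_1"
proof (induction s arbitrary: k)
  case (Suc s)
  have "fps_nth (geometric_fps c ^ Suc s) k = (\<Sum>i=0..k. c ^ i * (c ^ (k - i) * fps_nth (geometric_fps 1 ^ s) (k - i)))"
    by (simp add: fps_mult_nth Suc)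
  also have "\<dots> = (\<Sum>i=0..k. c ^ k * fps_nth (geometric_fps 1 ^ s) (k - i))"
    by (intro sum.cong refl) (simp add: mult.assoc[symmetric] power_add[symmetric])
  finally show ?case
    by (simp add: fps_mult_nth sum_distrib_left)
qed simp

lemma geometric_fps_power_nth_Rats: "fps_nth (geometric_fps (1::real) ^ s) k \<in> \<rat>"
  by (induction s arbitrary: k) (auto simp: fps_mult_nth intro!: Rats_sum)

lemma shifted_inverse_power_nth:
  "fps_nth (shifted_inverse n ^ s) k
     = 2 ^ s * fps_nth (geometric_fps 1 ^ s) k / (2 * real n - 1) ^ (s + k)"
  by (simp add: shifted_inverse_def power_mult_distrib fps_const_power geometric_fps_power_nth[of "1 / _"]
      power_divide power_add)

text \<open>Embeds real series in x into series in x over series in y, with coefficients constant in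
  y.\<close>

definition lift_fps :: "real fps \<Rightarrow> real fps fps" where
  "lift_fps f = Abs_fps (\<lambda>i. fps_const (fps_nth f i))"

lemma lift_fps_nth [simp]: "fps_nth (lift_fps f) i = fps_const (fps_nth f i)"
  by (simp add: lift_fps_def)

lemma fps_const_sum: "fps_const (sum f A) = (\<Sum>x\<in>A. fps_const (f x))"
  by (induction A rule: infinite_finite_induct) (simp_all flip: fps_const_add)

lemma lift_fps_mult: "lift_fps (f * g) = lift_fps f * lift_fps g"
  by (rule fps_ext) (simp add: fps_mult_nth fps_const_sum)

lemma lift_fps_1 [simp]: "lift_fps 1 = 1"
  by (rule fps_ext) simp

lemma lift_fps_prod: "lift_fps (prod f A) = (\<Prod>x\<in>A. lift_fps (f x))"
  by (induction A rule: infinite_finite_induct) (simp_all add: lift_fps_mult)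

lemma lift_geometric_fps: "lift_fps (geometric_fps c) = geometric_fps (fps_const c)"
  by (rule fps_ext) (simp add: fps_const_power)

lemma lift_linear: "lift_fps (1 + fps_const c * fps_X) = 1 + fps_const (fps_const c) * fps_X"
  by (rule fps_ext) (auto simp: fps_X_def fps_one_def)

section \<open>The Gamma quotient and Newton's identities\<close>

text \<open>The outer variable is \<open>x\<close> and the coefficients are series in \<open>y\<close>.\<close>

definition gamma_ratio :: "nat \<Rightarrow> real fps fps" where
  "gamma_ratio N = (\<Prod>n=1..N. (1 - fps_const (shifted_inverse n) * fps_X)
     * geometric_fps (fps_const (1 / real n)))"

lemma gamma_ratio_nth_0: "fps_nth (gamma_ratio N) 0 = 1"
  by (induction N) (simp_all add: gamma_ratio_def)

text \<open>For \<open>r = 0\<close> both power sums diverge in degree 0 of y; only their difference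
  has a limit.\<close>

definition power_sum_defect :: "nat \<Rightarrow> nat \<Rightarrow> real fps" where
  "power_sum_defect N r = (\<Sum>n=1..N. fps_const (1 / real n ^ Suc r) - shifted_inverse n ^ Suc r)"

text \<open>Compare the coefficients of x^m in the identity for the logarithmic derivative.\<close>

lemma gamma_ratio_newton:
  "of_nat (Suc m) * fps_nth (gamma_ratio N) (Suc m)
     = (\<Sum>i=0..m. fps_nth (gamma_ratio N) i * power_sum_defect N (m - i))"
proof -
  have "fps_nth (\<Sum>n=1..N. fps_const (fps_const (1 / real n)) * geometric_fps (fps_const (1 / real n))
      - fps_const (shifted_inverse n) * geometric_fps (shifted_inverse n)) r = power_sum_defect N r" for r
    unfolding power_sum_defect_def fps_sum_nth fps_sub_nth fps_mult_left_const_nth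
    by (simp add: fps_const_power power_divide)
  then have "fps_nth (fps_deriv (gamma_ratio N)) m
      = (\<Sum>i=0..m. fps_nth (gamma_ratio N) i * power_sum_defect N (m - i))"
    unfolding gamma_ratio_def fps_deriv_prod_ratio by (simp only: fps_mult_nth)
  then show ?thesis
    by simp
qed

text \<open>The coefficient of y^k in the (r+1)-st power of u_n is a rational multiple of
  1/(2n-1)^(r+1+k). Exponents at least 2 give zeta values; the case r = k = 0 is an alternating
  harmonic series and gives log 2.\<close>

lemma tendsto_power_sum_defect:
  "\<exists>L\<in>zeta_log_ring. (\<lambda>N. fps_nth (power_sum_defect N r) k) \<longlonglongrightarrow> L"
proof -
  define q where "q = 2 ^ Suc r * fps_nth (geometric_fps (1::real) ^ Suc r) k"
  \<comment> \<open>The constant series of 1/n^(r+1) contributes only in degree 0 of y.\<close>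
  define \<delta> :: real where "\<delta> = (if k = 0 then 1 else 0)"
  have q: "q \<in> \<rat>"
    unfolding q_def by (intro Rats_mult Rats_power geometric_fps_power_nth_Rats) auto
  have nth: "fps_nth (power_sum_defect N r) k
      = (\<Sum>n<N. \<delta> * (1 / real (Suc n) ^ Suc r) - q * (1 / (2 * real (Suc n) - 1) ^ (Suc r + k)))" for N
    unfolding power_sum_defect_def fps_sum_nth fps_sub_nth shifted_inverse_power_nth q_def \<delta>_def
    by (simp add: sum.atLeast1_atMost_eq)
  show ?thesis
  proof (cases "r + k = 0")
    case True
    then have rk: "r = 0" "k = 0"
      by auto
    \<comment> \<open>This is 1/(n+1) - 2/(2n+1) = -2 (1/(2n+1) - 1/(2n+2)).\<close>
    have summand: "-2 * (inverse (real_of_nat (2 * n + 1)) - inverse (real_of_nat (2 * n + 2)))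
      = \<delta> * (1 / real (Suc n) ^ Suc r) - q * (1 / (2 * real (Suc n) - 1) ^ (Suc r + k))" for n
    proof -
      have "inverse (real_of_nat (2 * n + 2)) = 1 / real (Suc n) / 2"
        by (simp add: field_simps)
      moreover have "\<delta> * (1 / real (Suc n) ^ Suc r) - q * (1 / (2 * real (Suc n) - 1) ^ (Suc r + k))
          = 1 / real (Suc n) - 2 * inverse (real_of_nat (2 * n + 1))"
        by (simp add: rk \<delta>_def q_def divide_inverse)
      moreover have "-2 * (x - y) = d" if "y = z / 2" "d = z - 2 * x" for x y z d :: real
        using that by simp
      ultimately show ?thesis
        by blast
    qed
    have "(\<lambda>n. -2 * (inverse (real_of_nat (2 * n + 1)) - inverse (real_of_nat (2 * n + 2)))) sums (-2 * ln 2)"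
      by (intro sums_mult alternating_harmonic_series_sums')
    then have "(\<lambda>N. fps_nth (power_sum_defect N r) k) \<longlonglongrightarrow> -2 * ln 2"
      unfolding summand sums_def nth .
    moreover have "-2 * ln 2 \<in> zeta_log_ring"
      by (intro rational_adjoin.mult rational_adjoin.rational rational_adjoin.generator) auto
    ultimately show ?thesis
      by blast
  next
    case False
    \<comment> \<open>For r = 0 < k the argument \<open>Suc r\<close> is 1, where the zeta series
      diverges; there \<delta> = 0.\<close>
    let ?L = "\<delta> * zeta_value (Suc r) - q * ((1 - 1 / 2 ^ (Suc r + k)) * zeta_value (Suc r + k))"
    have "(\<lambda>n. \<delta> * (1 / real (Suc n) ^ Suc r)) sums (\<delta> * zeta_value (Suc r))"
    proof (cases "k = 0")
      case True
      then show ?thesis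
        using False by (intro sums_mult zeta_value_sums) auto
    qed (simp add: \<delta>_def)
    moreover have "(\<lambda>n. q * (1 / (2 * real (Suc n) - 1) ^ (Suc r + k)))
        sums (q * ((1 - 1 / 2 ^ (Suc r + k)) * zeta_value (Suc r + k)))"
      using False by (intro sums_mult odd_zeta_sums) auto
    ultimately have "(\<lambda>N. fps_nth (power_sum_defect N r) k) \<longlonglongrightarrow> ?L"
      unfolding nth sums_def[symmetric] by (intro sums_diff)
    moreover have "\<delta> * zeta_value (Suc r) \<in> zeta_log_ring"
    proof (cases "k = 0")
      case True
      then show ?thesis
        using False zeta_value_in_ring[of "Suc r"] by (simp add: \<delta>_def)
    qed (simp add: \<delta>_def rational_adjoin.rational)
    moreover have "q * ((1 - 1 / 2 ^ (Suc r + k)) * zeta_value (Suc r + k)) \<in> zeta_log_ring"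
      by (rule rational_adjoin.mult[OF rational_adjoin.rational[OF q] odd_zeta_in_ring]) (use False in auto)
    ultimately have "(\<lambda>N. fps_nth (power_sum_defect N r) k) \<longlonglongrightarrow> ?L" "?L \<in> zeta_log_ring"
      unfolding diff_conv_add_uminus by (blast intro: rational_adjoin.add rational_adjoin_minus)+
    then show ?thesis
      by blast
  qed
qed

text \<open>Newton's identities make each coefficient a rational polynomial in coefficients of lower
  degree in x and in power sum defects, so strong induction on m applies.\<close>

lemma tendsto_gamma_ratio_nth:
  "\<exists>L\<in>zeta_log_ring. (\<lambda>N. fps_nth (fps_nth (gamma_ratio N) m) k) \<longlonglongrightarrow> L"
proof (induction m arbitrary: k rule: less_induct)
  case (less m)
  show ?case
  proof (cases m)
    case 0
    have "fps_nth (1 :: real fps) k \<in> zeta_log_ring"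
      by (intro rational_adjoin.rational) simp
    then show ?thesis
      unfolding 0 gamma_ratio_nth_0 by blast
  next
    case (Suc m')
    \<comment> \<open>\<open>lim\<close> names the limits already known to exist, so that the
      convolution converges to the same expression in \<open>w\<close> and \<open>q\<close>.\<close>
    define w q where "w i j = lim (\<lambda>N. fps_nth (fps_nth (gamma_ratio N) i) j)"
      and "q r j = lim (\<lambda>N. fps_nth (power_sum_defect N r) j)" for i j r
    have w: "w i j \<in> zeta_log_ring" "(\<lambda>N. fps_nth (fps_nth (gamma_ratio N) i) j) \<longlonglongrightarrow> w i j"
      if "i < m" for i j
      using less[OF that, of j] by (auto simp: w_def limI)
    have q: "q r j \<in> zeta_log_ring" "(\<lambda>N. fps_nth (power_sum_defect N r) j) \<longlonglongrightarrow> q r j" for r j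
      using tendsto_power_sum_defect[of r j] by (auto simp: q_def limI)
    let ?L = "1 / real (Suc m') * (\<Sum>i=0..m'. \<Sum>j=0..k. w i j * q (m' - i) (k - j))"
    have "fps_nth (fps_nth (gamma_ratio N) m) k = 1 / real (Suc m') *
        (\<Sum>i=0..m'. \<Sum>j=0..k. fps_nth (fps_nth (gamma_ratio N) i) j * fps_nth (power_sum_defect N (m' - i)) (k - j))" for N
    proof -
      have "real (Suc m') * fps_nth (fps_nth (gamma_ratio N) m) k
         = fps_nth (of_nat (Suc m') * fps_nth (gamma_ratio N) (Suc m')) k"
        unfolding Suc fps_of_nat[symmetric] by (simp only: fps_mult_left_const_nth)
      also have "\<dots> = (\<Sum>i=0..m'. \<Sum>j=0..k. fps_nth (fps_nth (gamma_ratio N) i) j * fps_nth (power_sum_defect N (m' - i)) (k - j))"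
        unfolding gamma_ratio_newton by (simp add: fps_sum_nth fps_mult_nth)
      finally show ?thesis
        by (simp add: field_simps)
    qed
    moreover have "(\<lambda>N. 1 / real (Suc m') *
        (\<Sum>i=0..m'. \<Sum>j=0..k. fps_nth (fps_nth (gamma_ratio N) i) j * fps_nth (power_sum_defect N (m' - i)) (k - j))) \<longlonglongrightarrow> ?L"
      by (intro tendsto_mult tendsto_const tendsto_sum w q) (auto simp: Suc)
    moreover have "?L \<in> zeta_log_ring"
      by (intro rational_adjoin.mult rational_adjoin_sum w q rational_adjoin.rational) (auto simp: Suc)
    ultimately show ?thesis
      by auto
  qed
qed

subsection \<open>The limit as a multiple \<open>R\<close>-value\<close>

text \<open>The expansion of the reciprocal of (1 - x/(a+1)) ... (1 - x/(a+n)); its coefficients are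
  complete homogeneous symmetric polynomials.\<close>

definition inverse_poch_fps :: "nat \<Rightarrow> nat \<Rightarrow> real fps" where
  "inverse_poch_fps a n = (\<Prod>j=1..n. geometric_fps (1 / real (a + j)))"

lemma inverse_poch_fps_Suc:
  "inverse_poch_fps a (Suc n) = inverse_poch_fps a n * geometric_fps (1 / real (a + Suc n))"
  by (simp add: inverse_poch_fps_def add_ac)

lemma inverse_poch_fps_add:
  "inverse_poch_fps a (m + n) = inverse_poch_fps a m * inverse_poch_fps (a + m) n"
proof (induction n)
  case (Suc n)
  then show ?case
    by (simp only: add_Suc_right inverse_poch_fps_Suc add.assoc mult.assoc)
qed (simp add: inverse_poch_fps_def)

lemma inverse_poch_fps_nth_nonneg: "fps_nth (inverse_poch_fps a n) i \<ge> 0"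
  by (induction n arbitrary: i)
     (auto simp: inverse_poch_fps_def fps_mult_nth fps_one_nth intro!: sum_nonneg mult_nonneg_nonneg)

text \<open>The convolution is dominated term by term by the binomial expansion of
  (\<open>harm n\<close> + 1/(n+1))^i. Uniformity in \<open>a\<close> is what Tannery's theorem will
  require.\<close>

lemma inverse_poch_fps_nth_le: "fps_nth (inverse_poch_fps a n) i \<le> harm n ^ i"
proof (induction n arbitrary: i)
  case (Suc n)
  have "fps_nth (inverse_poch_fps a (Suc n)) i
      = (\<Sum>j=0..i. fps_nth (inverse_poch_fps a n) j * (1 / real (a + Suc n)) ^ (i - j))"
    unfolding inverse_poch_fps_Suc fps_mult_nth geometric_fps_nth ..
  also have "\<dots> \<le> (\<Sum>j=0..i. of_nat (i choose j) * harm n ^ j * (1 / real (Suc n)) ^ (i - j))"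
  proof (rule sum_mono)
    fix j
    assume "j \<in> {0..i}"
    then have "1 \<le> i choose j"
      by (simp add: Suc_leI)
    then have "1 * harm n ^ j \<le> real (i choose j) * harm n ^ j"
      by (intro mult_right_mono) (auto simp: harm_nonneg)
    then have "fps_nth (inverse_poch_fps a n) j \<le> real (i choose j) * harm n ^ j"
      using Suc[of j] by simp
    moreover have "(1 / real (a + Suc n)) ^ (i - j) \<le> (1 / real (Suc n)) ^ (i - j)"
      by (intro power_mono) (auto simp: field_simps)
    ultimately show "fps_nth (inverse_poch_fps a n) j * (1 / real (a + Suc n)) ^ (i - j)
        \<le> of_nat (i choose j) * harm n ^ j * (1 / real (Suc n)) ^ (i - j)"
      by (intro mult_mono) (auto simp: harm_nonneg)
  qed
  also have "\<dots> = harm (Suc n) ^ i"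
    unfolding harm_Suc binomial_ring by (simp add: atLeast0AtMost divide_inverse)
  finally show ?case .
qed (simp add: inverse_poch_fps_def harm_expand fps_one_nth)

lemma tendsto_fps_mult_nth:
  fixes f g :: "'b \<Rightarrow> real fps"
  assumes "\<And>i. ((\<lambda>N. fps_nth (f N) i) \<longlongrightarrow> fps_nth a i) F" "\<And>i. ((\<lambda>N. fps_nth (g N) i) \<longlongrightarrow> fps_nth b i) F"
  shows "((\<lambda>N. fps_nth (f N * g N) i) \<longlongrightarrow> fps_nth (a * b) i) F"
  unfolding fps_mult_nth by (intro tendsto_intros assms)

lemma tendsto_inverse_poch_fps_nth:
  "(\<lambda>a. fps_nth (inverse_poch_fps a n) i) \<longlonglongrightarrow> fps_nth 1 i"
proof (induction n arbitrary: i)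
  case (Suc n)
  have "(\<lambda>a. fps_nth (geometric_fps (1 / real (a + Suc n))) i) \<longlonglongrightarrow> fps_nth 1 i" for i
  proof (cases "i = 0")
    case False
    have "(\<lambda>a. 1 / real (a + Suc n)) \<longlonglongrightarrow> 0"
      by real_asymp
    from tendsto_power[OF this, of i] False show ?thesis
      by (simp only: geometric_fps_nth fps_one_nth power_0_left if_False)
  qed simp
  from tendsto_fps_mult_nth[OF Suc this] show ?case
    by (simp only: inverse_poch_fps_Suc mult_1_left)
qed (simp add: inverse_poch_fps_def)

definition harmonic_fps :: "nat \<Rightarrow> real fps" where
  "harmonic_fps n = (\<Prod>j=1..n. 1 + fps_const (1 / real j) * fps_X)"

lemma harmonic_fps_nth: "fps_nth (harmonic_fps n) m = elem_sym (\<lambda>j. 1 / real j) n m"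
proof (induction "\<lambda>j. 1 / real j" n m rule: elem_sym.induct)
  case (1 n)
  then show ?case
    by (induction n) (simp_all add: harmonic_fps_def)
next
  case (3 n m)
  show ?case
  proof -
    have "p * (1 + fps_const c * fps_X) = p + fps_const c * (fps_X * p)" for p :: "real fps" and c
      by (simp add: algebra_simps)
    then have "harmonic_fps (Suc n) = harmonic_fps n + fps_const (1 / real (Suc n)) * (fps_X * harmonic_fps n)"
      by (simp add: harmonic_fps_def)
    then show ?thesis
      using 3 by simp
  qed
qed (simp add: harmonic_fps_def)

text \<open>Expand the product of the 1 - u_n x into partial fractions and divide by the product of
  the 1 - x/j over j \<le> N. In the n-th term the factors with j \<le> N - n cancel, leaving the n
  factors from N - n + 1 to N.\<close>

lemma gamma_ratio_partial_fractions:
  "gamma_ratio N = lift_fps (inverse_poch_fps 0 N) - fps_X * (\<Sum>n=1..N. fps_const (shifted_inverse n)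
     * lift_fps (harmonic_fps (n - 1) * inverse_poch_fps (N - n) n))"
proof -
  define r where "r j = fps_const (fps_const (1 / real j))" for j
  define J where "J = lift_fps (inverse_poch_fps 0 N)"
  define G where "G n = (\<Prod>j=1..n. 1 - fps_X * r j)" for n
  have G_mult: "G n * lift_fps (inverse_poch_fps 0 n) = 1" for n
  proof -
    have "G n * lift_fps (inverse_poch_fps 0 n)
       = (\<Prod>j=1..n. (1 - fps_const (fps_const (1 / real j)) * fps_X) * geometric_fps (fps_const (1 / real j)))"
      by (simp add: G_def inverse_poch_fps_def lift_fps_prod lift_geometric_fps r_def prod.distrib mult.commute)
    then show ?thesis
      by (simp only: one_minus_times_geometric_fps prod.neutral_const)
  qed
  have partial_fractions: "(\<Prod>n=1..N. 1 - fps_X * fps_const (shifted_inverse n))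
    = 1 - fps_X * (\<Sum>n=1..N. fps_const (shifted_inverse n) * (\<Prod>j=1..<n. 1 + fps_X * r j) * G (N - n))"
    unfolding G_def
  proof (rule prod_one_minus_partial_fractions)
    fix j :: nat
    assume "j > 0"
    then show "r j * of_nat j = 1"
      by (simp add: r_def fps_of_nat[symmetric])
  next
    fix n j :: nat
    assume "0 < n" "n < j"
    from arg_cong[OF shifted_inverse_resolvent[OF this], of fps_const]
    show "fps_const (shifted_inverse n) * fps_const (shifted_inverse j) * of_nat (j - n)
        = fps_const (shifted_inverse n) - fps_const (shifted_inverse j)"
      by (simp only: fps_of_nat[symmetric] fps_const_mult[symmetric] fps_const_sub[symmetric])
  qed
  have "1 + fps_X * r j = lift_fps (1 + fps_const (1 / real j) * fps_X)" for j
    unfolding lift_linear r_def by (simp add: mult.commute)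
  then have harmonic: "(\<Prod>j=1..<n. 1 + fps_X * r j) = lift_fps (harmonic_fps (n - 1))" if "n > 0" for n
    using that by (cases n) (simp_all add: harmonic_fps_def lift_fps_prod atLeastLessThanSuc_atLeastAtMost)
  have quotient: "G (N - n) * J = lift_fps (inverse_poch_fps (N - n) n)" if "n \<in> {1..N}" for n
  proof -
    have "J = lift_fps (inverse_poch_fps 0 (N - n)) * lift_fps (inverse_poch_fps (N - n) n)"
      using inverse_poch_fps_add[of 0 "N - n" n] that by (simp add: J_def lift_fps_mult)
    then have "G (N - n) * J = (G (N - n) * lift_fps (inverse_poch_fps 0 (N - n))) * lift_fps (inverse_poch_fps (N - n) n)"
      by (simp only: mult.assoc)
    then show ?thesis
      by (simp only: G_mult mult_1_left)
  qed
  have "gamma_ratio N = (\<Prod>n=1..N. 1 - fps_X * fps_const (shifted_inverse n)) * J"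
    by (simp add: gamma_ratio_def J_def inverse_poch_fps_def lift_fps_prod lift_geometric_fps prod.distrib
        mult.commute)
  also have "\<dots> = J - fps_X * (\<Sum>n=1..N. fps_const (shifted_inverse n) * (\<Prod>j=1..<n. 1 + fps_X * r j) * (G (N - n) * J))"
    unfolding partial_fractions by (simp add: left_diff_distrib sum_distrib_right mult.assoc)
  also have "(\<Sum>n=1..N. fps_const (shifted_inverse n) * (\<Prod>j=1..<n. 1 + fps_X * r j) * (G (N - n) * J))
     = (\<Sum>n=1..N. fps_const (shifted_inverse n) * lift_fps (harmonic_fps (n - 1) * inverse_poch_fps (N - n) n))"
  proof (rule sum.cong[OF refl])
    fix n
    assume n: "n \<in> {1..N}"
    then have "n > 0"
      by simp
    show "fps_const (shifted_inverse n) * (\<Prod>j=1..<n. 1 + fps_X * r j) * (G (N - n) * J)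
        = fps_const (shifted_inverse n) * lift_fps (harmonic_fps (n - 1) * inverse_poch_fps (N - n) n)"
      unfolding quotient[OF n] harmonic[OF \<open>n > 0\<close>] lift_fps_mult by (simp only: mult.assoc)
  qed
  finally show ?thesis
    by (simp only: J_def)
qed

text \<open>Lifted series are constant in y, so for k > 0 the leading term drops out and y^k arises
  from \<open>shifted_inverse\<close> alone.\<close>

lemma gamma_ratio_nth:
  assumes "k > 0"
  shows "fps_nth (fps_nth (gamma_ratio N) (Suc m)) k
     = - (\<Sum>i<N. 2 / (2 * real i + 1) ^ Suc k
            * fps_nth (harmonic_fps i * inverse_poch_fps (N - Suc i) (Suc i)) m)"
  using assms unfolding gamma_ratio_partial_fractions
  by (simp add: fps_sum_nth shifted_inverse_nth sum.atLeast1_atMost_eq fps_mult_left_const_nth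
      fps_mult_right_const_nth add.commute)

text \<open>Each of the m + 1 convolution terms is at most the m-th power of
  \<open>harm (Suc i)\<close>, whatever \<open>a\<close> is.\<close>

lemma harmonic_fps_mult_inverse_poch_fps_nth:
  "0 \<le> fps_nth (harmonic_fps i * inverse_poch_fps a (Suc i)) m"
  "fps_nth (harmonic_fps i * inverse_poch_fps a (Suc i)) m \<le> real (Suc m) * (1 + ln (real (Suc i))) ^ m"
proof -
  let ?h = "harm (Suc i) :: real"
  show "0 \<le> fps_nth (harmonic_fps i * inverse_poch_fps a (Suc i)) m"
    by (auto simp: fps_mult_nth harmonic_fps_nth
        intro!: sum_nonneg mult_nonneg_nonneg elem_sym_nonneg inverse_poch_fps_nth_nonneg)
  have "fps_nth (harmonic_fps i * inverse_poch_fps a (Suc i)) m \<le> (\<Sum>j=0..m. ?h ^ m)"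
    unfolding fps_mult_nth
  proof (rule sum_mono)
    fix j
    assume j: "j \<in> {0..m}"
    have "fps_nth (harmonic_fps i) j \<le> harm i ^ j"
      unfolding harmonic_fps_nth by (rule elem_sym_le_power) auto
    also have "\<dots> \<le> ?h ^ j"
      by (intro power_mono harm_mono) (auto simp: harm_nonneg)
    finally have "fps_nth (harmonic_fps i) j * fps_nth (inverse_poch_fps a (Suc i)) (m - j) \<le> ?h ^ j * ?h ^ (m - j)"
      by (intro mult_mono inverse_poch_fps_nth_le inverse_poch_fps_nth_nonneg) (auto simp: harm_nonneg)
    then show "fps_nth (harmonic_fps i) j * fps_nth (inverse_poch_fps a (Suc i)) (m - j) \<le> ?h ^ m"
      using j by (simp add: power_add[symmetric])
  qed
  also have "\<dots> = real (Suc m) * ?h ^ m"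
    by simp
  also have "\<dots> \<le> real (Suc m) * (1 + ln (real (Suc i))) ^ m"
    by (intro mult_left_mono power_mono harm_le_1_plus_ln) (auto simp: harm_nonneg)
  finally show "fps_nth (harmonic_fps i * inverse_poch_fps a (Suc i)) m
      \<le> real (Suc m) * (1 + ln (real (Suc i))) ^ m" .
qed

text \<open>\<open>suminf f\<close> is the sum V. Tannery's theorem makes it the limit of minus the
  coefficient of x^(m+1) y^k in \<open>gamma_ratio N\<close>, and Newton's identities put the limit
  of that coefficient into the ring.\<close>

lemma odd_harmonic_series:
  fixes m k :: nat
  assumes "k > 0"
  defines "f \<equiv> \<lambda>i. 2 * elem_sym (\<lambda>j. 1 / real j) i m / (2 * real i + 1) ^ Suc k"
  shows "summable f" "suminf f \<in> zeta_log_ring"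
proof -
  \<comment> \<open>Extension by 0 turns the finite sums into series over all i.\<close>
  define a where "a i N = (if i < N then 2 / (2 * real i + 1) ^ Suc k
      * fps_nth (harmonic_fps i * inverse_poch_fps (N - Suc i) (Suc i)) m else 0)" for i N
  \<comment> \<open>Since k \<ge> 1, the exponent \<open>Suc k\<close> may be lowered to 2; the
    bound is independent of N.\<close>
  define M where "M i = 2 / (2 * real i + 1) ^ 2 * (real (Suc m) * (1 + ln (real (Suc i))) ^ m)" for i
  have lim: "(\<lambda>N. a i N) \<longlonglongrightarrow> f i" for i
  proof -
    have "(\<lambda>N. fps_nth (inverse_poch_fps (N - Suc i) (Suc i)) j) \<longlonglongrightarrow> fps_nth 1 j" for j
      by (rule filterlim_compose[OF tendsto_inverse_poch_fps_nth]) (rule filterlim_minus_const_nat_at_top)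
    from tendsto_fps_mult_nth[OF tendsto_const this]
    have "(\<lambda>N. 2 / (2 * real i + 1) ^ Suc k
        * fps_nth (harmonic_fps i * inverse_poch_fps (N - Suc i) (Suc i)) m) \<longlonglongrightarrow>
        2 / (2 * real i + 1) ^ Suc k * fps_nth (harmonic_fps i * 1) m"
      by (intro tendsto_mult_left)
    moreover have "2 / (2 * real i + 1) ^ Suc k * fps_nth (harmonic_fps i * 1) m = f i"
      by (simp add: f_def harmonic_fps_nth)
    moreover have "\<forall>\<^sub>F N in sequentially. a i N = 2 / (2 * real i + 1) ^ Suc k
        * fps_nth (harmonic_fps i * inverse_poch_fps (N - Suc i) (Suc i)) m"
      using eventually_gt_at_top[of i] by eventually_elim (simp add: a_def)
    ultimately show ?thesis
      by (simp add: tendsto_cong)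
  qed
  have bound: "norm (a i N) \<le> M i" for i N
  proof -
    have "2 / (2 * real i + 1) ^ Suc k \<le> 2 / (2 * real i + 1) ^ 2"
      using assms by (intro divide_left_mono power_increasing) auto
    then have "2 / (2 * real i + 1) ^ Suc k
        * fps_nth (harmonic_fps i * inverse_poch_fps (N - Suc i) (Suc i)) m \<le> M i"
      unfolding M_def by (intro mult_mono harmonic_fps_mult_inverse_poch_fps_nth) auto
    moreover have "0 \<le> 2 / (2 * real i + 1) ^ Suc k
        * fps_nth (harmonic_fps i * inverse_poch_fps (N - Suc i) (Suc i)) m"
      by (intro mult_nonneg_nonneg harmonic_fps_mult_inverse_poch_fps_nth) auto
    ultimately show ?thesis
      by (simp add: a_def)
  qed
  \<comment> \<open>\<open>M\<close> is of order i^(-2) up to a power of log i, so any exponent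
    strictly between -2 and -1 serves for comparison.\<close>
  have "summable (\<lambda>i. real (Suc i) powr (-3/2))"
    by (subst summable_Suc_iff[of "\<lambda>n. real n powr (-3/2)"]) (simp add: summable_real_powr_iff)
  then have "summable (\<lambda>i. norm (real (Suc i) powr (-3/2)))"
    by simp
  then have "summable M"
    by (rule summable_comparison_test_bigo) (unfold M_def, real_asymp)
  moreover have "\<forall>\<^sub>F (i, N) in at_top \<times>\<^sub>F sequentially. norm (a i N) \<le> M i"
    using bound by (intro always_eventually) auto
  ultimately have tannery: "summable (\<lambda>i. norm (f i))" "(\<lambda>N. suminf (\<lambda>i. a i N)) \<longlonglongrightarrow> suminf f"
    using tannerys_theorem[where F = sequentially, OF lim] by auto
  show "summable f"
    by (rule summable_norm_cancel[OF tannery(1)])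
  have "suminf (\<lambda>i. a i N) = - fps_nth (fps_nth (gamma_ratio N) (Suc m)) k" for N
  proof -
    have "suminf (\<lambda>i. a i N) = (\<Sum>i<N. a i N)"
      by (rule suminf_finite) (auto simp: a_def)
    then show ?thesis
      unfolding gamma_ratio_nth[OF assms(1)] by (simp add: a_def)
  qed
  then have "(\<lambda>N. - fps_nth (fps_nth (gamma_ratio N) (Suc m)) k) \<longlonglongrightarrow> suminf f"
    using tannery(2) by simp
  moreover obtain L where L: "L \<in> zeta_log_ring" "(\<lambda>N. fps_nth (fps_nth (gamma_ratio N) (Suc m)) k) \<longlonglongrightarrow> L"
    using tendsto_gamma_ratio_nth by blast
  ultimately have "suminf f = - L"
    using LIMSEQ_unique tendsto_minus by blast
  then show "suminf f \<in> zeta_log_ring"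
    using L by (simp add: rational_adjoin_minus)
qed

section \<open>Tuple sums and the interchange of summation\<close>

lemma multiple_t_harmonic_ones:
  "multiple_t_harmonic n (replicate k 1) = elem_sym (\<lambda>j. 1 / (2 * real j - 1)) n k"
proof -
  have "multiple_t_harmonic n (replicate k 1)
     = (\<Sum>ns\<in>bounded_decreasing_tuples n k. prod_list (map (\<lambda>j. 1 / (2 * real j - 1)) ns))"
    unfolding multiple_t_harmonic_def length_replicate
    by (intro sum.cong refl) (auto simp: prod_nth_eq_prod_list[symmetric]
        bounded_decreasing_tuples_def decreasing_tuples_def)
  then show ?thesis
    by (simp only: sum_bounded_decreasing_tuples)
qed

text \<open>Group the tuples by their largest entry i + 1; the tails have entries at most i and sum
  to \<open>elem_sym\<close>. Of the power 2^(m+1) left after division by 2^k, the part 2^m cancels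
  the even denominators and the remaining 2 is the one in the summand of V.\<close>

lemma multiple_R_value_ones:
  assumes "(\<lambda>i. 2 * elem_sym (\<lambda>j. 1 / real j) i m / (2 * real i + 1) ^ Suc k) sums V"
  shows "1 / 2 ^ k * multiple_R_value ((k + 1) # replicate m 1) = V"
proof -
  \<comment> \<open>The summand of R, with the factors 2 of its m even denominators collected into
    2^m.\<close>
  define g where "g ns = 1 / ((2 * real (ns ! 0) - 1) ^ Suc k * 2 ^ m)
      * prod_list (map (\<lambda>j. 1 / real j) (tl ns))" for ns :: "nat list"
  have Sigma: "decreasing_tuples (Suc m)
      = (\<lambda>(i, ns). Suc i # ns) ` (SIGMA i:UNIV. bounded_decreasing_tuples i m)" (is "_ = ?c ` ?S")
  proof (intro equalityI subsetI)
    fix ns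
    assume ns: "ns \<in> decreasing_tuples (Suc m)"
    then obtain l xs where "ns = l # xs" "l > 0"
      by (auto simp: decreasing_tuples_def length_Suc_conv)
    moreover obtain i where "l = Suc i"
      using \<open>l > 0\<close> gr0_conv_Suc by auto
    ultimately have "ns = ?c (i, xs)" "(i, xs) \<in> ?S"
      using ns by (auto simp: decreasing_tuples_def bounded_decreasing_tuples_def less_Suc_eq_le)
    then show "ns \<in> ?c ` ?S"
      by blast
  qed (auto simp: decreasing_tuples_def bounded_decreasing_tuples_def less_Suc_eq_le)
  have inner: "((\<lambda>ns. g (?c (i, ns))) has_sum
      (1 / 2 ^ Suc m * (2 * elem_sym (\<lambda>j. 1 / real j) i m / (2 * real i + 1) ^ Suc k))) (bounded_decreasing_tuples i m)" for i
  proof -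
    have "(\<Sum>ns\<in>bounded_decreasing_tuples i m. g (?c (i, ns)))
        = 1 / ((2 * real i + 1) ^ Suc k * 2 ^ m) * elem_sym (\<lambda>j. 1 / real j) i m"
      by (simp add: g_def add.commute sum_distrib_left[symmetric] sum_divide_distrib[symmetric]
          sum_bounded_decreasing_tuples)
    also have "\<dots> = 1 / 2 ^ Suc m * (2 * elem_sym (\<lambda>j. 1 / real j) i m / (2 * real i + 1) ^ Suc k)"
      by simp
    finally show ?thesis
      using has_sum_finite[OF finite_bounded_decreasing_tuples] by metis
  qed
  have outer: "((\<lambda>i. 1 / 2 ^ Suc m * (2 * elem_sym (\<lambda>j. 1 / real j) i m / (2 * real i + 1) ^ Suc k)) has_sum (1 / 2 ^ Suc m * V)) UNIV"
    by (intro sums_nonneg_imp_has_sum sums_mult assms mult_nonneg_nonneg divide_nonneg_nonneg elem_sym_nonneg) auto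
  have nonneg: "g (?c (i, ns)) \<ge> 0" for i ns
  proof -
    have "prod_list (map (\<lambda>j. 1 / real j) ns) \<ge> 0"
      by (induction ns) auto
    then show ?thesis
      by (simp add: g_def)
  qed
  have "((\<lambda>p. g (?c p)) has_sum (1 / 2 ^ Suc m * V)) ?S"
    by (rule has_sum_SigmaI[OF inner outer])
       (rule summable_on_SigmaI[OF inner has_sum_imp_summable[OF outer] nonneg])
  moreover have "inj_on ?c ?S"
    by (auto simp: inj_on_def)
  ultimately have "(g has_sum (1 / 2 ^ Suc m * V)) (decreasing_tuples (Suc m))"
    unfolding Sigma by (simp add: has_sum_reindex o_def)
  moreover have "g ns = 1 / ((2 * real (ns ! 0) - 1) ^ (((k + 1) # replicate m 1) ! 0) *
             (\<Prod>j=1..<Suc m. (2 * real (ns ! j)) ^ (((k + 1) # replicate m 1) ! j)))"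
    if tuple: "ns \<in> decreasing_tuples (Suc m)" for ns
  proof -
    obtain l xs where ns: "ns = l # xs" "length xs = m"
      using tuple by (cases ns) (auto simp: decreasing_tuples_def)
    have "(\<Prod>j=1..<Suc m. (2 * real (ns ! j)) ^ (((k + 1) # replicate m 1) ! j)) = (\<Prod>j<m. 2 * real (xs ! j))"
      unfolding ns(1) by (rule prod.reindex_bij_witness[of _ Suc "\<lambda>j. j - 1"]) (auto simp: nth_Cons')
    also have "\<dots> = 2 ^ m * (\<Prod>j<m. real (xs ! j))"
      by (simp add: prod.distrib)
    finally show ?thesis
      unfolding ns(2)[symmetric] using ns by (simp add: g_def prod_nth_eq_prod_list[symmetric] prod_dividef)
  qed
  ultimately have "(\<Sum>\<^sub>\<infinity>ns\<in>decreasing_tuples (Suc m). 1 / ((2 * real (ns ! 0) - 1) ^ (((k + 1) # replicate m 1) ! 0) *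
             (\<Prod>j=1..<Suc m. (2 * real (ns ! j)) ^ (((k + 1) # replicate m 1) ! j)))) = 1 / 2 ^ Suc m * V"
    by (metis (no_types, lifting) has_sum_cong infsumI)
  then show ?thesis
    by (simp add: multiple_R_value_def sum_list_replicate power_add)
qed

theorem theorem6p5:
  fixes m k :: nat
  assumes "k \<ge> 1"
  shows "(\<lambda>i. let n = Suc i in
            1 / 4 ^ n * real ((2 * n) choose n) *
            (multiple_t_harmonic n (replicate k 1) / real n ^ (m + 1)))
         sums (1 / 2 ^ k * multiple_R_value ((k + 1) # replicate m 1))
       \<and> 1 / 2 ^ k * multiple_R_value ((k + 1) # replicate m 1)
           \<in> rational_adjoin ({ln 2} \<union> {zeta_value s | s. s \<ge> 2})"
proof -
  define e where "e = elem_sym (\<lambda>j. 1 / real j)"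
  define f where "f i = 2 * e i m / (2 * real i + 1) ^ Suc k" for i
  have f: "summable f" "suminf f \<in> zeta_log_ring"
    using odd_harmonic_series[of k m] assms unfolding f_def[abs_def] e_def by auto
  have V: "1 / 2 ^ k * multiple_R_value ((k + 1) # replicate m 1) = suminf f"
    using summable_sums[OF f(1)] by (intro multiple_R_value_ones) (simp only: f_def[abs_def] e_def)
  have e_nonneg: "e l m \<ge> 0" for l
    by (simp add: e_def elem_sym_nonneg)
  \<comment> \<open>The connected double series. Its row and column sums are the terms of the two
    series to be compared; \<open>l\<close> is shifted by one, hence \<open>Suc l\<close>.\<close>
  define a where "a = (\<lambda>(l, n). t_weight n k * connector n (Suc l) * (e l m / real (Suc l)))"
  have a_nonneg: "a p \<ge> 0" for p
    by (auto simp: a_def e_nonneg t_weight_nonneg connector_nonneg split: prod.split)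
  have rows: "((\<lambda>n. a (l, n)) has_sum f l) UNIV" for l
  proof (rule sums_nonneg_imp_has_sum[OF _ a_nonneg])
    have "f l = 2 * real (Suc l) / (2 * real l + 1) ^ Suc k * (e l m / real (Suc l))"
      unfolding f_def by (simp del: of_nat_Suc)
    then show "(\<lambda>n. a (l, n)) sums f l"
      using sums_mult2[OF t_weight_connector_sums, of k l "e l m / real (Suc l)"]
      by (simp only: a_def prod.case)
  qed
  have f_sum: "(f has_sum suminf f) UNIV"
    by (intro sums_nonneg_imp_has_sum summable_sums f) (simp add: f_def e_nonneg)
  have "(a has_sum suminf f) (UNIV \<times> UNIV)"
    by (rule has_sum_SigmaI[OF rows f_sum])
       (rule summable_on_SigmaI[OF rows has_sum_imp_summable[OF f_sum] a_nonneg])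
  then have "((\<lambda>(n, l). a (l, n)) has_sum suminf f) (UNIV \<times> UNIV)"
    by (subst (asm) has_sum_swap)
  \<comment> \<open>At n = 0 all terms vanish because \<open>t_weight 0 k = 0\<close> for k \<ge> 1,
    and the right side is 0/0 = 0.\<close>
  moreover have "((\<lambda>l. (\<lambda>(n, l). a (l, n)) (n, l)) has_sum t_weight n k / real n ^ Suc m) UNIV" for n
  proof (cases "n = 0")
    case True
    then show ?thesis
      using assms by (simp add: a_def t_weight_0)
  next
    case False
    have "(\<lambda>l. a (l, n)) sums (t_weight n k * (1 / real n ^ Suc m))"
      using sums_mult[OF harmonic_elem_sym_connector_sums[of n m]] False
      by (simp add: a_def e_def mult_ac)
    then show ?thesis
      using sums_nonneg_imp_has_sum[OF _ a_nonneg] by simp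
  qed
  ultimately have "((\<lambda>n. t_weight n k / real n ^ Suc m) has_sum suminf f) UNIV"
    by (rule has_sum_SigmaD)
  \<comment> \<open>The term at n = 0 is zero, so the summation may start at n = 1.\<close>
  then have "(\<lambda>i. t_weight (Suc i) k / real (Suc i) ^ Suc m) sums suminf f"
    using assms by (subst sums_Suc_iff) (simp add: has_sum_imp_sums t_weight_0)
  then have "(\<lambda>i. let n = Suc i in 1 / 4 ^ n * real ((2 * n) choose n) *
      (multiple_t_harmonic n (replicate k 1) / real n ^ (m + 1))) sums suminf f"
    unfolding Let_def multiple_t_harmonic_ones t_weight_def central_weight_def by simp
  then show ?thesis
    unfolding V using f(2) by simp
qed

end
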